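(* Let $A\in\mathbb{R}^{m\times n}$ have full row rank and let $\mathbf{b}\in\mathbb{R}^m$ be nonzero. Define $$\alpha^* := \inf_{\mathbf{x}\in\mathbb{R}^n}\left\{\frac{\|\mathbf{x}\|_1}{\|\mathbf{x}\|_2}\ \text{ s.t. }\ A\mathbf{x}=\mathbf{b}\right\},$$ and, for a positive parameter $\alpha$, $$T(\alpha) := \inf_{\mathbf{x}\in\mathbb{R}^n}\left\{\|\mathbf{x}\|_1-\alpha\|\mathbf{x}\|_2\ \text{ s.t. }\ A\mathbf{x}=\mathbf{b}\right\}.$$ Then, for every $\alpha>0$: (a) if $T(\alpha)<0$, then $\alpha>\alpha^*$; (b) if $T(\alpha)\ge 0$, then $\alpha\le\alpha^*$; (c) if $T(\alpha)=0$, then $\alpha=\alpha^*$.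
   Context: $\|\cdot\|_1$ and $\|\cdot\|_2$ are the $\ell_1$ and Euclidean norms on $\mathbb{R}^n$. The infimum $T(\alpha)$ is taken in $[-\infty,\infty)$, so the value $-\infty$ is allowed (and counts as $T(\alpha)<0$). The feasible set $\{\mathbf{x}: A\mathbf{x}=\mathbf{b}\}$ is nonempty because $A$ has full row rank, and does not contain $\mathbf{0}$ because $\mathbf{b}\ne\mathbf{0}$. *)

theory Defs
  imports "HOL-Analysis.Analysis"
begin

definition l1_norm :: "real ^ 'n \<Rightarrow> real" where
  "l1_norm x = (\<Sum>i\<in>UNIV. \<bar>x $ i\<bar>)"

text \<open>
  Both infima are taken in \<^typ>\<open>ereal\<close>: the second one may be \<open>-\<infinity>\<close>, which the \<^typ>\<open>real\<close>-valued
  infimum would not represent. The Euclidean norm is \<^const>\<open>norm\<close> on \<open>real ^ 'n\<close>.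
\<close>

definition ratio_inf :: "real ^ 'n ^ 'm \<Rightarrow> real ^ 'm \<Rightarrow> ereal" where
  "ratio_inf A b = (INF x\<in>{x. A *v x = b}. ereal (l1_norm x / norm x))"

definition diff_inf :: "real ^ 'n ^ 'm \<Rightarrow> real ^ 'm \<Rightarrow> real \<Rightarrow> ereal" where
  "diff_inf A b \<alpha> = (INF x\<in>{x. A *v x = b}. ereal (l1_norm x - \<alpha> * norm x))"

end

theory Submission
  imports Defs
begin

text \<open>
  For a feasible \<open>x\<close>, which is nonzero because \<open>b \<noteq> 0\<close>, the inequalities
  \<open>l1_norm x - \<alpha> * norm x \<ge> 0\<close> and \<open>l1_norm x / norm x \<ge> \<alpha>\<close> are equivalent. Taking infima,
  \<open>diff_inf A b \<alpha> \<ge> 0\<close> holds iff \<open>\<alpha> \<le> ratio_inf A b\<close>, which gives (b) and, by negation, (a).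

  For (c) it remains to exclude \<open>diff_inf A b \<alpha> = 0\<close> with \<open>\<alpha> < ratio_inf A b\<close>. Strict
  positivity of each \<open>l1_norm x - \<alpha> * norm x\<close> is not enough for this, because it may be lost in the
  infimum; a uniform positive lower bound is needed. The feasible set, a closed set without \<open>0\<close>,
  stays at some distance \<open>\<delta> > 0\<close> from the origin. If \<open>\<alpha> < c \<le> ratio_inf A b\<close>, then every feasible
  \<open>x\<close> satisfies \<open>l1_norm x - \<alpha> * norm x \<ge> (c - \<alpha>) * norm x \<ge> (c - \<alpha>) * \<delta>\<close>, and the
  right-hand side is a positive constant; hence \<open>diff_inf A b \<alpha> > 0\<close>.
\<close>

lemma feasible_bounded_away_from_zero:
  fixes A :: "real ^ 'n ^ 'm" and b :: "real ^ 'm"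
  assumes "b \<noteq> 0"
  obtains \<delta> where "\<delta> > 0" and "\<And>x. A *v x = b \<Longrightarrow> \<delta> \<le> norm x"
proof -
  obtain K where "K > 0" and K: "\<And>x. norm (A *v x) \<le> norm x * K"
    using bounded_linear.pos_bounded[OF matrix_vector_mul_bounded_linear[of A]] by blast
  show thesis
  proof (rule that)
    show "norm b / K > 0"
      using \<open>K > 0\<close> assms by simp
    show "norm b / K \<le> norm x" if "A *v x = b" for x
      using K[of x] that \<open>K > 0\<close> by (simp add: pos_divide_le_eq)
  qed
qed

lemma le_ratio_inf_iff:
  fixes A :: "real ^ 'n ^ 'm" and b :: "real ^ 'm"
  assumes "b \<noteq> 0"
  shows "ereal c \<le> ratio_inf A b \<longleftrightarrow> (\<forall>x. A *v x = b \<longrightarrow> c * norm x \<le> l1_norm x)"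
proof -
  have "x \<noteq> 0" if "A *v x = b" for x
    using that assms by auto
  then show ?thesis
    by (auto simp: ratio_inf_def le_INF_iff pos_le_divide_eq)
qed

lemma diff_inf_nonneg_iff:
  fixes A :: "real ^ 'n ^ 'm" and b :: "real ^ 'm"
  assumes "b \<noteq> 0"
  shows "0 \<le> diff_inf A b \<alpha> \<longleftrightarrow> ereal \<alpha> \<le> ratio_inf A b"
  by (simp add: le_ratio_inf_iff[OF assms] diff_inf_def le_INF_iff)

lemma diff_inf_pos_if_less_ratio_inf:
  fixes A :: "real ^ 'n ^ 'm" and b :: "real ^ 'm"
  assumes "b \<noteq> 0" and "ereal \<alpha> < ratio_inf A b"
  shows "0 < diff_inf A b \<alpha>"
proof -
  \<comment> \<open>An intermediate real is needed because \<open>ratio_inf A b\<close> is \<open>\<infinity>\<close> when nothing is feasible.\<close>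
  obtain c where "\<alpha> < c" and "ereal c \<le> ratio_inf A b"
    using ereal_dense2[OF assms(2)] by (auto simp: less_imp_le)
  then have c: "c * norm x \<le> l1_norm x" if "A *v x = b" for x
    using that le_ratio_inf_iff[OF assms(1)] by blast
  obtain \<delta> where "\<delta> > 0" and \<delta>: "\<And>x. A *v x = b \<Longrightarrow> \<delta> \<le> norm x"
    using feasible_bounded_away_from_zero[OF assms(1)] by blast
  have "(c - \<alpha>) * \<delta> \<le> l1_norm x - \<alpha> * norm x" if "A *v x = b" for x
  proof -
    have "(c - \<alpha>) * \<delta> \<le> (c - \<alpha>) * norm x"
      using \<delta>[OF that] \<open>\<alpha> < c\<close> by (simp add: mult_left_mono)
    also have "\<dots> \<le> l1_norm x - \<alpha> * norm x"
      using c[OF that] by (simp add: algebra_simps)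
    finally show ?thesis .
  qed
  then have "ereal ((c - \<alpha>) * \<delta>) \<le> diff_inf A b \<alpha>"
    by (simp add: diff_inf_def le_INF_iff)
  moreover have "0 < ereal ((c - \<alpha>) * \<delta>)"
    using \<open>\<alpha> < c\<close> \<open>\<delta> > 0\<close> by simp
  ultimately show ?thesis
    by (rule less_le_trans[rotated])
qed

theorem proposition1:
  fixes A :: "real ^ 'n ^ 'm" and b :: "real ^ 'm" and \<alpha> :: real
  assumes "rank A = CARD('m)" and "b \<noteq> 0" and "\<alpha> > 0"
  shows "(diff_inf A b \<alpha> < 0 \<longrightarrow> ereal \<alpha> > ratio_inf A b)
    \<and> (diff_inf A b \<alpha> \<ge> 0 \<longrightarrow> ereal \<alpha> \<le> ratio_inf A b)
    \<and> (diff_inf A b \<alpha> = 0 \<longrightarrow> ereal \<alpha> = ratio_inf A b)"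
proof (intro conjI impI)
  note sign = diff_inf_nonneg_iff[OF \<open>b \<noteq> 0\<close>, of A \<alpha>]
  show "ereal \<alpha> > ratio_inf A b" if "diff_inf A b \<alpha> < 0"
    using that sign by (simp add: not_le[symmetric])
  show "ereal \<alpha> \<le> ratio_inf A b" if "diff_inf A b \<alpha> \<ge> 0"
    using that sign by simp
  show "ereal \<alpha> = ratio_inf A b" if "diff_inf A b \<alpha> = 0"
  proof (rule antisym)
    show "ereal \<alpha> \<le> ratio_inf A b"
      using that sign by simp
    show "ratio_inf A b \<le> ereal \<alpha>"
      using that diff_inf_pos_if_less_ratio_inf[OF \<open>b \<noteq> 0\<close>, of \<alpha> A] by (force simp: not_less[symmetric])
  qed
qed

end
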